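(* Let $\sigma$ be the algebra endomorphism of $\mathcal{A}=\mathbb{C}[t^{\pm1}]$ defined by $\sigma(t)=qt^s$, with $q\in\mathbb{C}^*$, $s\in\mathbb{Z}$ and $\sigma\neq\mathrm{id}$. Let $d=|s-1|$ and $\mathbb{Z}_d=\mathbb{Z}/d\mathbb{Z}$ (in particular $\mathbb{Z}_0=\mathbb{Z}$ when $s=1$), and for $k\in\mathbb{Z}$ let $\overline{k}=k+d\mathbb{Z}\in\mathbb{Z}_d$. Let $T=qt^{s-1}$. Then the nonassociative algebra $(\mathcal{D}_\sigma(\mathcal{A}),[\cdot,\cdot]_\sigma)$ is $\mathbb{Z}_d$-graded: $$\mathcal{D}_\sigma(\mathcal{A})=\bigoplus_{\overline{k}\in\mathbb{Z}_d}\mathcal{D}_{\overline{k}},\qquad \mathcal{D}_{\overline{k}}=\mathbb{C}[T^{\pm1}]\,d_k\ \text{ for any } k\in\overline{k},$$ that is, this is a direct sum decomposition of vector spaces, $\mathbb{C}[T^{\pm1}]d_k$ depends only on the class $\overline{k}$, and $[\mathcal{D}_{\overline{k}},\mathcal{D}_{\overline{l}}]_\sigma\subseteq\mathcal{D}_{\overline{k}+\overline{l}}$ for all $\overline{k},\overline{l}\in\mathbb{Z}_d$.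
   Context: A $\sigma$-derivation of $\mathcal{A}$ is a $\mathbb{C}$-linear map $D:\mathcal{A}\to\mathcal{A}$ with $D(ab)=\sigma(a)D(b)+D(a)b$ for all $a,b\in\mathcal{A}$; $\mathcal{D}_\sigma(\mathcal{A})$ is the set of all of them, a left $\mathcal{A}$-module via $(a\Delta)(r)=a\Delta(r)$. Put $g=1-\lambda t^d$ with $\lambda=q$, $d=s-1$ if $s\geq1$, and $\lambda=q^{-1}$, $d=1-s$ if $s<1$; this $g$ is a greatest common divisor of $(\mathrm{id}-\sigma)(\mathcal{A})$. Let $\Delta=(\mathrm{id}-\sigma)/g$; then $\mathcal{D}_\sigma(\mathcal{A})=\mathcal{A}\Delta$ is free of rank one over $\mathcal{A}$. For $n\in\mathbb{Z}$ let $d_n=-t^n\Delta$. The bracket is the $\mathbb{C}$-bilinear product on $\mathcal{D}_\sigma(\mathcal{A})$ given by $$[a\Delta,b\Delta]_\sigma=(\sigma(a)\Delta)\circ(b\Delta)-(\sigma(b)\Delta)\circ(a\Delta)=\big(\sigma(a)\Delta(b)-\sigma(b)\Delta(a)\big)\Delta,\quad a,b\in\mathcal{A}.$$ $\mathbb{C}[T^{\pm1}]$ denotes the subalgebra of $\mathcal{A}$ generated by $T$ and $T^{-1}$ (equal to $\mathbb{C}$ when $s=1$). *)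

theory Defs
  imports
    "HOL-Algebra.IntRing"
    "HOL-Library.Poly_Mapping"
    "HOL-Library.Function_Algebras"
    Complex_Main
begin

section \<open>Laurent polynomials\<close>

text \<open>
  The ring \<open>\<complex>[t\<^sup>\<plusminus>\<^sup>1]\<close> is the group algebra of the integers, i.e. finitely supported functions
  with the convolution product; \<open>Poly_Mapping.single n c\<close> is the monomial \<open>c t\<^sup>n\<close>.
\<close>

type_synonym laurent = "int \<Rightarrow>\<^sub>0 complex"

definition lscale :: "complex \<Rightarrow> laurent \<Rightarrow> laurent"
  where "lscale c a = Poly_Mapping.map ((*) c) a"

definition lmap_scale :: "complex \<Rightarrow> (laurent \<Rightarrow> laurent) \<Rightarrow> (laurent \<Rightarrow> laurent)"
  where "lmap_scale c D = (\<lambda>r. lscale c (D r))"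

definition alg_endo :: "(laurent \<Rightarrow> laurent) \<Rightarrow> bool"
  where "alg_endo \<sigma> \<longleftrightarrow>
    Vector_Spaces.linear lscale lscale \<sigma> \<and> \<sigma> 1 = 1 \<and> (\<forall>a b. \<sigma> (a * b) = \<sigma> a * \<sigma> b)"

definition subalgebra :: "laurent set \<Rightarrow> bool"
  where "subalgebra S \<longleftrightarrow>
    module.subspace lscale S \<and> 1 \<in> S \<and> (\<forall>a\<in>S. \<forall>b\<in>S. a * b \<in> S)"


section \<open>Twisted derivations and their bracket\<close>

definition sigma_derivations :: "(laurent \<Rightarrow> laurent) \<Rightarrow> (laurent \<Rightarrow> laurent) set"
  where "sigma_derivations \<sigma> =
    {D. Vector_Spaces.linear lscale lscale D \<and> (\<forall>a b. D (a * b) = \<sigma> a * D b + D a * b)}"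

definition lact :: "laurent \<Rightarrow> (laurent \<Rightarrow> laurent) \<Rightarrow> (laurent \<Rightarrow> laurent)"
  where "lact a D = (\<lambda>r. a * D r)"

definition gcd_elt :: "complex \<Rightarrow> int \<Rightarrow> laurent"
  where "gcd_elt q s =
    (if s \<ge> 1 then 1 - Poly_Mapping.single (s - 1) q
     else 1 - Poly_Mapping.single (1 - s) (inverse q))"

text \<open>
  \<open>Delta q s \<sigma> = (id - \<sigma>) / g\<close> with \<open>g = gcd_elt q s\<close>; the quotient exists and is unique when
  \<open>\<sigma>\<close> is the endomorphism with \<open>\<sigma>(t) = q t\<^sup>s\<close> and \<open>\<sigma> \<noteq> id\<close> (lemma \<open>Delta_eq\<close> below).
\<close>

definition Delta :: "complex \<Rightarrow> int \<Rightarrow> (laurent \<Rightarrow> laurent) \<Rightarrow> (laurent \<Rightarrow> laurent)"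
  where "Delta q s \<sigma> a = (THE b. gcd_elt q s * b = a - \<sigma> a)"

text \<open>
  The coefficient \<open>a\<close> of \<open>D = a \<Delta>\<close>; it is unique, and exists for every twisted derivation \<open>D\<close>
  (lemmas \<open>coeff_of_lact\<close> and \<open>sigma_derivations_eq\<close> below).
\<close>

definition coeff_of :: "(laurent \<Rightarrow> laurent) \<Rightarrow> (laurent \<Rightarrow> laurent) \<Rightarrow> laurent"
  where "coeff_of \<Delta> D = (THE a. D = lact a \<Delta>)"

definition sigma_bracket :: "(laurent \<Rightarrow> laurent) \<Rightarrow> (laurent \<Rightarrow> laurent) \<Rightarrow>
    (laurent \<Rightarrow> laurent) \<Rightarrow> (laurent \<Rightarrow> laurent) \<Rightarrow> (laurent \<Rightarrow> laurent)"
  where "sigma_bracket \<sigma> \<Delta> D E =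
    (let a = coeff_of \<Delta> D; b = coeff_of \<Delta> E in
      (lact (\<sigma> a) \<Delta> \<circ> lact b \<Delta>) - (lact (\<sigma> b) \<Delta> \<circ> lact a \<Delta>))"


section \<open>The components of the grading\<close>

definition basis_elt :: "(laurent \<Rightarrow> laurent) \<Rightarrow> int \<Rightarrow> (laurent \<Rightarrow> laurent)"
  where "basis_elt \<Delta> n = lact (- Poly_Mapping.single n 1) \<Delta>"

definition T_elt :: "complex \<Rightarrow> int \<Rightarrow> laurent"
  where "T_elt q s = Poly_Mapping.single (s - 1) q"

definition T_inv :: "complex \<Rightarrow> int \<Rightarrow> laurent"
  where "T_inv q s = Poly_Mapping.single (1 - s) (inverse q)"

definition T_algebra :: "complex \<Rightarrow> int \<Rightarrow> laurent set"
  where "T_algebra q s = subalgebra hull {T_elt q s, T_inv q s}"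

definition T_span :: "complex \<Rightarrow> int \<Rightarrow> (laurent \<Rightarrow> laurent) \<Rightarrow> int \<Rightarrow> (laurent \<Rightarrow> laurent) set"
  where "T_span q s \<Delta> k = {lact f (basis_elt \<Delta> k) | f. f \<in> T_algebra q s}"

text \<open>
  \<open>ZFact \<bar>s - 1\<bar>\<close> is the quotient ring \<open>\<int>/d\<int>\<close> whose carrier is the set of cosets \<open>k + d\<int>\<close>; for
  \<open>d = 0\<close> these are the singletons. A component is given by an arbitrary representative of its
  class; that the choice is immaterial is asserted as a conclusion of the main theorem.
\<close>

definition component :: "complex \<Rightarrow> int \<Rightarrow> (laurent \<Rightarrow> laurent) \<Rightarrow> int set \<Rightarrow> (laurent \<Rightarrow> laurent) set"
  where "component q s \<Delta> K = T_span q s \<Delta> (SOME k. k \<in> K)"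

text \<open>
  \<open>V\<close> is the internal direct sum of the (possibly infinite) family \<open>(W i)\<close> for \<open>i \<in> I\<close>: every vector
  of \<open>V\<close> is uniquely a sum of finitely many nonzero components.
\<close>

definition is_direct_sum :: "('k::field \<Rightarrow> 'v::ab_group_add \<Rightarrow> 'v) \<Rightarrow> 'v set \<Rightarrow> 'i set \<Rightarrow> ('i \<Rightarrow> 'v set) \<Rightarrow> bool"
  where "is_direct_sum scale V I W \<longleftrightarrow>
    module.subspace scale V \<and>
    (\<forall>i\<in>I. module.subspace scale (W i) \<and> W i \<subseteq> V) \<and>
    (\<forall>v\<in>V. \<exists>!w. (\<forall>i\<in>I. w i \<in> W i) \<and> (\<forall>i. i \<notin> I \<longrightarrow> w i = 0) \<and>
       finite {i. w i \<noteq> 0} \<and> v = (\<Sum>i | w i \<noteq> 0. w i))"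


section \<open>Well-definedness\<close>

lemma lscale_conv: "lscale c a = Poly_Mapping.single 0 c * a"
  by (simp add: lscale_def mult_map_scale_conv_mult)

lemma lscale_single: "lscale c (Poly_Mapping.single n x) = Poly_Mapping.single n (c * x)"
  by (simp add: lscale_conv mult_single)

lemma vector_space_lscale: "vector_space lscale"
  by unfold_locales
    (simp_all add: lscale_conv algebra_simps single_add mult_single flip: mult.assoc)

lemma vector_space_lmap_scale: "vector_space lmap_scale"
proof -
  interpret vector_space lscale by (rule vector_space_lscale)
  show ?thesis
    by unfold_locales
      (simp_all add: lmap_scale_def plus_fun_def fun_eq_iff scale_right_distrib scale_left_distrib)
qed

lemma linear_iff_lscale:
  "Vector_Spaces.linear lscale lscale f \<longleftrightarrow>
     (\<forall>a b. f (a + b) = f a + f b) \<and> (\<forall>c a. f (lscale c a) = lscale c (f a))"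
  by (auto simp: Vector_Spaces.linear_def module_hom_def module_hom_axioms_def
      vector_space_lscale module_iff_vector_space)

lemma laurent_induct [case_names single add]:
  assumes single: "\<And>n c. P (Poly_Mapping.single n c)" and add: "\<And>a b. P a \<Longrightarrow> P b \<Longrightarrow> P (a + b)"
  shows "P (a :: laurent)"
proof -
  have "P (\<Sum>k\<in>S. Poly_Mapping.single k (Poly_Mapping.lookup a k))" if "finite S" for S
    using that
  proof (induction S)
    case empty
    then show ?case using single[of 0 0] by simp
  qed (simp add: single add)
  moreover have "a = (\<Sum>k\<in>Poly_Mapping.keys a. Poly_Mapping.single k (Poly_Mapping.lookup a k))"
    by (rule poly_mapping_eqI)
      (auto simp: lookup_sum lookup_single when_def in_keys_iff)
  ultimately show ?thesis by (metis finite_keys)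
qed

lemma T_elt_mult_T_inv: "q \<noteq> 0 \<Longrightarrow> T_elt q s * T_inv q s = 1"
  by (simp add: T_elt_def T_inv_def mult_single)

lemma linear_eqI:
  assumes f: "Vector_Spaces.linear lscale lscale f" and g: "Vector_Spaces.linear lscale lscale g"
    and eq: "\<And>n. f (Poly_Mapping.single n 1) = g (Poly_Mapping.single n 1)"
  shows "f = g"
proof
  fix a
  show "f a = g a"
  proof (induction a rule: laurent_induct)
    case (single n c)
    have "Poly_Mapping.single n c = lscale c (Poly_Mapping.single n 1)"
      by (simp add: lscale_single)
    then show ?case using f g eq by (simp add: linear_iff_lscale)
  next
    case (add a b)
    then show ?case using f g by (simp add: linear_iff_lscale)
  qed
qed

lemma endo_single:
  assumes q: "q \<noteq> 0" and endo: "alg_endo \<sigma>"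
    and t: "\<sigma> (Poly_Mapping.single 1 1) = Poly_Mapping.single s q"
  shows "\<sigma> (Poly_Mapping.single n c) = Poly_Mapping.single (s * n) (c * q powi n)"
proof -
  have mult: "\<sigma> (a * b) = \<sigma> a * \<sigma> b" and scale: "\<sigma> (lscale c a) = lscale c (\<sigma> a)"
    and one: "\<sigma> 1 = 1" for a b c
    using endo by (simp_all add: alg_endo_def linear_iff_lscale)
  have "\<sigma> (Poly_Mapping.single n 1) = Poly_Mapping.single (s * n) (q powi n)"
  proof (induction n rule: int_induct[where k = 0])
    case base
    then show ?case by (simp add: one)
  next
    case (step1 i)
    have *: "Poly_Mapping.single (i + 1) 1 = Poly_Mapping.single i 1 * Poly_Mapping.single 1 (1 :: complex)"
      by (simp add: mult_single)
    have "\<sigma> (Poly_Mapping.single (i + 1) 1) = Poly_Mapping.single (s * i) (q powi i) * Poly_Mapping.single s q"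
      unfolding * mult step1 t ..
    then show ?case
      by (simp add: mult_single power_int_add q distrib_left)
  next
    case (step2 i)
    let ?u = "Poly_Mapping.single s q" and ?v = "Poly_Mapping.single (- s) (inverse q)"
    have "Poly_Mapping.single i 1 = Poly_Mapping.single (i - 1) 1 * Poly_Mapping.single 1 (1 :: complex)"
      by (simp add: mult_single)
    then have *: "Poly_Mapping.single (s * i) (q powi i) = \<sigma> (Poly_Mapping.single (i - 1) 1) * ?u"
      using step2(2) by (metis mult t)
    have "\<sigma> (Poly_Mapping.single (i - 1) 1) = \<sigma> (Poly_Mapping.single (i - 1) 1) * ?u * ?v"
      using q by (simp add: mult.assoc mult_single)
    also have "\<dots> = Poly_Mapping.single (s * (i - 1)) (q powi (i - 1))"
      unfolding *[symmetric] using q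
      by (simp add: mult_single power_int_diff algebra_simps divide_inverse)
    finally show ?case .
  qed
  then show ?thesis
    using scale[of c "Poly_Mapping.single n 1"] by (simp add: lscale_single)
qed

lemma ex1_alg_endo:
  assumes q: "q \<noteq> 0"
  shows "\<exists>!\<sigma>. alg_endo \<sigma> \<and> \<sigma> (Poly_Mapping.single 1 1) = Poly_Mapping.single s q"
proof (rule ex_ex1I)
  define \<sigma> :: "laurent \<Rightarrow> laurent" where
    "\<sigma> a = (\<Sum>k\<in>Poly_Mapping.keys a.
      Poly_Mapping.single (s * k) (Poly_Mapping.lookup a k * q powi k))" for a
  have supset: "\<sigma> a = (\<Sum>k\<in>S. Poly_Mapping.single (s * k) (Poly_Mapping.lookup a k * q powi k))"
    if "finite S" "Poly_Mapping.keys a \<subseteq> S" for a S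
    unfolding \<sigma>_def using that by (intro sum.mono_neutral_left) (auto simp: in_keys_iff)
  have single: "\<sigma> (Poly_Mapping.single n c) = Poly_Mapping.single (s * n) (c * q powi n)" for n c
    using supset[of "{n}" "Poly_Mapping.single n c"] by simp
  have add: "\<sigma> (a + b) = \<sigma> a + \<sigma> b" for a b
  proof -
    let ?S = "Poly_Mapping.keys a \<union> Poly_Mapping.keys b"
    have "Poly_Mapping.keys (a + b) \<subseteq> ?S" by (rule Poly_Mapping.keys_add)
    then show ?thesis
      using supset[of ?S a] supset[of ?S b] supset[of ?S "a + b"]
      by (simp add: lookup_add distrib_right single_add sum.distrib)
  qed
  have one: "\<sigma> 1 = 1"
    using single[of 0 1] by simp
  have mult_single': "\<sigma> (Poly_Mapping.single n c * b) = \<sigma> (Poly_Mapping.single n c) * \<sigma> b" for n c b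
    using q by (induction b rule: laurent_induct)
      (simp_all add: mult_single single power_int_add algebra_simps add)
  have mult: "\<sigma> (a * b) = \<sigma> a * \<sigma> b" for a b
    by (induction a rule: laurent_induct) (simp_all add: mult_single' add distrib_right)
  have "\<sigma> (lscale c a) = lscale c (\<sigma> a)" for c a
    by (simp add: lscale_conv mult single)
  then have "alg_endo \<sigma>"
    by (simp add: alg_endo_def linear_iff_lscale add one mult)
  then show "\<exists>\<sigma>. alg_endo \<sigma> \<and> \<sigma> (Poly_Mapping.single 1 1) = Poly_Mapping.single s q"
    by (intro exI[of _ \<sigma>]) (simp add: single)
next
  fix \<sigma> \<tau>
  assume "alg_endo \<sigma> \<and> \<sigma> (Poly_Mapping.single 1 1) = Poly_Mapping.single s q"
    and "alg_endo \<tau> \<and> \<tau> (Poly_Mapping.single 1 1) = Poly_Mapping.single s q"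
  then show "\<sigma> = \<tau>"
    by (intro linear_eqI) (auto simp: alg_endo_def endo_single[OF q])
qed

lemma gcd_elt_nonzero:
  assumes q: "q \<noteq> 0" and endo: "alg_endo \<sigma>"
    and t: "\<sigma> (Poly_Mapping.single 1 1) = Poly_Mapping.single s q" and "\<sigma> \<noteq> id"
  shows "gcd_elt q s \<noteq> 0"
proof
  assume "gcd_elt q s = 0"
  then have "Poly_Mapping.lookup (gcd_elt q s) 0 = 0" by simp
  then have sq: "s = 1" "q = 1"
    by (auto simp: gcd_elt_def lookup_minus lookup_one lookup_single when_def split: if_splits)
  have "\<sigma> = id"
  proof (rule linear_eqI)
    show "Vector_Spaces.linear lscale lscale \<sigma>" using endo by (simp add: alg_endo_def)
    show "Vector_Spaces.linear lscale lscale id" by (simp add: linear_iff_lscale)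
  qed (use sq in \<open>simp add: endo_single[OF q endo t]\<close>)
  with assms show False by simp
qed

lemma gcd_elt_dvd:
  assumes q: "q \<noteq> 0" and endo: "alg_endo \<sigma>"
    and t: "\<sigma> (Poly_Mapping.single 1 1) = Poly_Mapping.single s q"
  shows "gcd_elt q s dvd a - \<sigma> a"
proof -
  define U where "U n = Poly_Mapping.single ((s - 1) * n) (q powi n)" for n
  have U_add: "U (m + n) = U m * U n" for m n
    using q by (simp add: U_def mult_single power_int_add distrib_left)
  have U0: "U 0 = 1" by (simp add: U_def)
  have neg: "1 - U (- n) = - U (- n) * (1 - U n)" for n
    using U_add[of "- n" n] by (simp add: U0 algebra_simps)
  have g: "gcd_elt q s dvd 1 - U 1"
  proof (cases "s \<ge> 1")
    case True
    then show ?thesis by (simp add: gcd_elt_def U_def)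
  next
    case False
    then have "gcd_elt q s = 1 - U (- 1)" by (simp add: gcd_elt_def U_def power_int_minus)
    then show ?thesis using neg[of "- 1"] by simp
  qed
  have nat: "gcd_elt q s dvd 1 - U (int n)" for n
  proof (induction n)
    case (Suc n)
    have "1 - U (int (Suc n)) = (1 - U (int n)) + U (int n) * (1 - U 1)"
      using U_add[of "int n" 1] by (simp add: algebra_simps)
    then show ?case using Suc g by (metis dvd_add dvd_mult)
  qed (simp add: U0)
  have U: "gcd_elt q s dvd 1 - U n" for n
  proof (cases n rule: int_cases2)
    case (nonneg m)
    then show ?thesis using nat by simp
  next
    case (nonpos m)
    then show ?thesis using nat neg by (metis dvd_mult)
  qed
  have lin: "\<sigma> (a + b) = \<sigma> a + \<sigma> b" for a b
    using endo by (simp add: alg_endo_def linear_iff_lscale)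
  show ?thesis
  proof (induction a rule: laurent_induct)
    case (single n c)
    have "Poly_Mapping.single n c - \<sigma> (Poly_Mapping.single n c) = Poly_Mapping.single n c * (1 - U n)"
      by (simp add: endo_single[OF q endo t] U_def right_diff_distrib mult_single algebra_simps)
    then show ?case using U by simp
  next
    case (add a b)
    have "a + b - \<sigma> (a + b) = (a - \<sigma> a) + (b - \<sigma> b)" by (simp add: lin)
    then show ?case using add by (metis dvd_add)
  qed
qed

lemma Delta_eq:
  assumes "q \<noteq> 0" "alg_endo \<sigma>" "\<sigma> (Poly_Mapping.single 1 1) = Poly_Mapping.single s q" "\<sigma> \<noteq> id"
  shows "gcd_elt q s * b = a - \<sigma> a \<longleftrightarrow> b = Delta q s \<sigma> a"
proof -
  have nz: "gcd_elt q s \<noteq> 0" by (rule gcd_elt_nonzero[OF assms])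
  obtain b0 where b0: "a - \<sigma> a = gcd_elt q s * b0"
    using gcd_elt_dvd[OF assms(1-3)] by (auto elim: dvdE)
  have "Delta q s \<sigma> a = b0"
    unfolding Delta_def by (rule the_equality) (use b0 nz in auto)
  then show ?thesis using b0 nz by auto
qed

lemma Delta_in_sigma_derivations:
  assumes "q \<noteq> 0" "alg_endo \<sigma>" "\<sigma> (Poly_Mapping.single 1 1) = Poly_Mapping.single s q" "\<sigma> \<noteq> id"
  shows "Delta q s \<sigma> \<in> sigma_derivations \<sigma>"
proof -
  have D: "gcd_elt q s * Delta q s \<sigma> a = a - \<sigma> a" for a
    using Delta_eq[OF assms] by blast
  have lin: "\<sigma> (a + b) = \<sigma> a + \<sigma> b" "\<sigma> (lscale c a) = lscale c (\<sigma> a)" "\<sigma> (a * b) = \<sigma> a * \<sigma> b"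
    for a b c
    using assms(2) by (simp_all add: alg_endo_def linear_iff_lscale)
  have "Delta q s \<sigma> (a + b) = Delta q s \<sigma> a + Delta q s \<sigma> b" for a b
    by (rule sym, subst Delta_eq[OF assms, symmetric]) (simp add: distrib_left D lin)
  moreover have "Delta q s \<sigma> (lscale c a) = lscale c (Delta q s \<sigma> a)" for a c
  proof (rule sym, subst Delta_eq[OF assms, symmetric])
    have "gcd_elt q s * lscale c (Delta q s \<sigma> a) = lscale c (gcd_elt q s * Delta q s \<sigma> a)"
      by (simp only: lscale_conv mult.left_commute)
    also have "\<dots> = lscale c a - \<sigma> (lscale c a)"
      by (simp only: D lin(2)) (simp only: lscale_conv right_diff_distrib)
    finally show "gcd_elt q s * lscale c (Delta q s \<sigma> a) = lscale c a - \<sigma> (lscale c a)" .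
  qed
  moreover have "Delta q s \<sigma> (a * b) = \<sigma> a * Delta q s \<sigma> b + Delta q s \<sigma> a * b" for a b
  proof (rule sym, subst Delta_eq[OF assms, symmetric])
    have "gcd_elt q s * (\<sigma> a * Delta q s \<sigma> b + Delta q s \<sigma> a * b) =
        \<sigma> a * (gcd_elt q s * Delta q s \<sigma> b) + gcd_elt q s * Delta q s \<sigma> a * b"
      by (simp only: distrib_left mult.assoc mult.left_commute)
    also have "\<dots> = a * b - \<sigma> (a * b)"
      by (simp only: D lin(3)) (simp add: algebra_simps)
    finally show "gcd_elt q s * (\<sigma> a * Delta q s \<sigma> b + Delta q s \<sigma> a * b) = a * b - \<sigma> (a * b)" .
  qed
  ultimately show ?thesis by (simp add: sigma_derivations_def linear_iff_lscale)
qed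

lemma Delta_t_unit:
  assumes "q \<noteq> 0" "alg_endo \<sigma>" "\<sigma> (Poly_Mapping.single 1 1) = Poly_Mapping.single s q" "\<sigma> \<noteq> id"
  obtains u where "u * Delta q s \<sigma> (Poly_Mapping.single 1 1) = 1"
proof (cases "s \<ge> 1")
  case True
  have "Poly_Mapping.single 1 1 = Delta q s \<sigma> (Poly_Mapping.single 1 1)"
    by (subst Delta_eq[OF assms, symmetric])
      (use True in \<open>simp add: gcd_elt_def assms(3) left_diff_distrib mult_single\<close>)
  then have "Poly_Mapping.single (- 1) 1 * Delta q s \<sigma> (Poly_Mapping.single 1 1) = 1"
    by (metis add.left_inverse mult_1 mult_single single_one)
  then show ?thesis by (rule that)
next
  case False
  have "Poly_Mapping.single s (- q) = Delta q s \<sigma> (Poly_Mapping.single 1 1)"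
    by (subst Delta_eq[OF assms, symmetric])
      (use False assms(1) in \<open>simp add: gcd_elt_def assms(3) left_diff_distrib mult_single single_uminus\<close>)
  then have "Poly_Mapping.single (- s) (- inverse q) * Delta q s \<sigma> (Poly_Mapping.single 1 1) = 1"
    using assms(1) by (metis add.left_inverse mult_single single_one minus_mult_minus left_inverse)
  then show ?thesis by (rule that)
qed

lemma sigma_derivation_eq_0:
  assumes endo: "alg_endo \<sigma>" and D: "D \<in> sigma_derivations \<sigma>" and t: "D (Poly_Mapping.single 1 1) = 0"
  shows "D = (\<lambda>_. 0)"
proof (rule linear_eqI)
  show lin: "Vector_Spaces.linear lscale lscale D" using D by (simp add: sigma_derivations_def)
  show "Vector_Spaces.linear lscale lscale (\<lambda>_. 0)" by (simp add: linear_iff_lscale lscale_conv)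
  have der: "D (a * b) = \<sigma> a * D b + D a * b" for a b
    using D by (simp add: sigma_derivations_def)
  have one: "\<sigma> 1 = 1" using endo by (simp add: alg_endo_def)
  fix n
  show "D (Poly_Mapping.single n 1) = 0"
  proof (induction n rule: int_induct[where k = 0])
    case base
    show ?case using der[of 1 1] by (simp add: one)
  next
    case (step1 i)
    then show ?case
      using der[of "Poly_Mapping.single i 1" "Poly_Mapping.single 1 1"] by (simp add: t mult_single)
  next
    case (step2 i)
    have "D (Poly_Mapping.single (i - 1) 1) * Poly_Mapping.single 1 1 = 0"
      using step2 der[of "Poly_Mapping.single (i - 1) 1" "Poly_Mapping.single 1 1"]
      by (simp add: t mult_single)
    moreover have "Poly_Mapping.single 1 1 \<noteq> (0 :: laurent)"
      by (metis lookup_single_eq lookup_zero zero_neq_one)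
    ultimately show ?case by simp
  qed
qed

lemma coeff_of_lact:
  assumes "q \<noteq> 0" "alg_endo \<sigma>" "\<sigma> (Poly_Mapping.single 1 1) = Poly_Mapping.single s q" "\<sigma> \<noteq> id"
  shows "coeff_of (Delta q s \<sigma>) (lact a (Delta q s \<sigma>)) = a"
proof -
  let ?d = "Delta q s \<sigma> (Poly_Mapping.single 1 1)"
  obtain u where u: "u * ?d = 1" by (rule Delta_t_unit[OF assms])
  then have "?d \<noteq> 0" by auto
  then show ?thesis
    unfolding coeff_of_def by (intro the_equality) (auto simp: lact_def fun_eq_iff)
qed

lemma sigma_derivations_eq:
  assumes "q \<noteq> 0" "alg_endo \<sigma>" "\<sigma> (Poly_Mapping.single 1 1) = Poly_Mapping.single s q" "\<sigma> \<noteq> id"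
  shows "sigma_derivations \<sigma> = range (\<lambda>a. lact a (Delta q s \<sigma>))"
proof -
  let ?\<Delta> = "Delta q s \<sigma>" and ?t = "Poly_Mapping.single 1 1"
  obtain u where u: "u * ?\<Delta> ?t = 1" by (rule Delta_t_unit[OF assms])
  have \<Delta>: "?\<Delta> (a + b) = ?\<Delta> a + ?\<Delta> b" "?\<Delta> (lscale c a) = lscale c (?\<Delta> a)"
    "?\<Delta> (a * b) = \<sigma> a * ?\<Delta> b + ?\<Delta> a * b" for a b c
    using Delta_in_sigma_derivations[OF assms] by (simp_all add: sigma_derivations_def linear_iff_lscale)
  have sub: "lact a ?\<Delta> \<in> sigma_derivations \<sigma>" for a
  proof -
    have "a * ?\<Delta> (lscale c b) = lscale c (a * ?\<Delta> b)" for b c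
      unfolding \<Delta>(2) by (simp only: lscale_conv mult.left_commute)
    moreover have "a * ?\<Delta> (b * c) = \<sigma> b * (a * ?\<Delta> c) + a * ?\<Delta> b * c" for b c
      unfolding \<Delta>(3) by (simp add: distrib_left mult.left_commute mult.assoc)
    ultimately show ?thesis
      by (simp add: sigma_derivations_def linear_iff_lscale lact_def \<Delta>(1) distrib_left)
  qed
  moreover have "\<exists>a. D = lact a ?\<Delta>" if D: "D \<in> sigma_derivations \<sigma>" for D
  proof -
    define E where "E x = D x - lact (D ?t * u) ?\<Delta> x" for x
    have DA: "F (a + b) = F a + F b" "F (lscale c a) = lscale c (F a)" "F (a * b) = \<sigma> a * F b + F a * b"
      if "F \<in> sigma_derivations \<sigma>" for F a b c
      using that by (simp_all add: sigma_derivations_def linear_iff_lscale)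
    note DA = DA[OF D] DA[OF sub]
    have "E (a + b) = E a + E b" for a b
      unfolding E_def DA by simp
    moreover have "E (lscale c a) = lscale c (E a)" for a c
      unfolding E_def DA by (simp only: lscale_conv right_diff_distrib)
    moreover have "E (a * b) = \<sigma> a * E b + E a * b" for a b
      unfolding E_def DA by (simp add: right_diff_distrib left_diff_distrib)
    ultimately have "E \<in> sigma_derivations \<sigma>"
      by (simp add: sigma_derivations_def linear_iff_lscale)
    moreover have "E ?t = 0"
      using u by (simp add: E_def lact_def mult.assoc)
    ultimately have "E = (\<lambda>_. 0)" by (rule sigma_derivation_eq_0[OF assms(2)])
    then have "D x - lact (D ?t * u) ?\<Delta> x = 0" for x
      by (metis E_def)
    then have "D = lact (D ?t * u) ?\<Delta>"
      by (metis eq_iff_diff_eq_0 ext)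
    then show ?thesis by blast
  qed
  ultimately show ?thesis by blast
qed

lemma sigma_bracket_lact:
  assumes "q \<noteq> 0" "alg_endo \<sigma>" "\<sigma> (Poly_Mapping.single 1 1) = Poly_Mapping.single s q" "\<sigma> \<noteq> id"
  shows "sigma_bracket \<sigma> (Delta q s \<sigma>) (lact a (Delta q s \<sigma>)) (lact b (Delta q s \<sigma>)) =
    lact (\<sigma> a * Delta q s \<sigma> b - \<sigma> b * Delta q s \<sigma> a) (Delta q s \<sigma>)"
proof -
  have der: "Delta q s \<sigma> (x * y) = \<sigma> x * Delta q s \<sigma> y + Delta q s \<sigma> x * y" for x y
    using Delta_in_sigma_derivations[OF assms] by (simp add: sigma_derivations_def)
  show ?thesis
    unfolding sigma_bracket_def coeff_of_lact[OF assms] Let_def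
    by (rule ext) (simp add: lact_def der fun_diff_def, simp only: algebra_simps)
qed

end

theory Submission
  imports Defs
begin

text \<open>
  By freeness, \<open>a \<mapsto> a \<Delta>\<close> identifies the twisted derivations with \<open>\<complex>[t\<^sup>\<plusminus>\<^sup>1]\<close>, and everything is read
  off from the exponents occurring in the coefficient \<open>a\<close>. Since \<open>T\<close> is a nonzero multiple of
  \<open>t\<^sup>s\<^sup>-\<^sup>1\<close>, the algebra \<open>\<complex>[T\<^sup>\<plusminus>\<^sup>1]\<close> consists of the Laurent polynomials with exponents divisible by
  \<open>d = \<bar>s - 1\<bar>\<close> (\<open>T_algebra_eq\<close>), so \<open>\<complex>[T\<^sup>\<plusminus>\<^sup>1] d\<^sub>k\<close> consists of the \<open>a \<Delta>\<close> where \<open>a\<close> has exponents in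
  \<open>k + d\<int>\<close> (\<open>T_span_eq\<close>). This description mentions only the class of \<open>k\<close>, and the residue classes
  partition \<open>\<int>\<close>, so sorting the terms of \<open>a\<close> by residue class gives the direct sum decomposition
  (\<open>is_direct_sum_supported_multiples\<close>).

  For the bracket \<open>[a \<Delta>, b \<Delta>] = (\<sigma>(a) \<Delta>(b) - \<sigma>(b) \<Delta>(a)) \<Delta>\<close> it suffices that \<open>\<sigma>\<close> and \<open>\<Delta>\<close>
  preserve each residue class of exponents, because multiplication adds classes. For \<open>\<sigma>\<close> this is the
  congruence \<open>s m \<equiv> m\<close> modulo \<open>d\<close> (\<open>endo_part\<close>). For \<open>\<Delta> = (id - \<sigma>) / g\<close>, the element \<open>g\<close> only has
  exponents divisible by \<open>d\<close>, so extracting the terms of one class commutes with multiplication by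
  \<open>g\<close>; by uniqueness of the quotient it then also commutes with division by \<open>g\<close> (\<open>Delta_part\<close>).
\<close>

section \<open>Supports of Laurent polynomials\<close>

text \<open>
  For a residue class \<open>K\<close> this is the projection onto a homogeneous component. Expressing homogeneity
  as a fixed point of \<open>part K\<close> turns statements about supports into commutation rules that can be
  checked on monomials.
\<close>

definition part :: "int set \<Rightarrow> laurent \<Rightarrow> laurent"
  where "part K a = Poly_Mapping.mapp (\<lambda>k c. c when k \<in> K) a"

lemma lookup_part: "Poly_Mapping.lookup (part K a) m = (Poly_Mapping.lookup a m when m \<in> K)"
  by (auto simp: part_def lookup_mapp when_def in_keys_iff)

lemma part_0 [simp]: "part K 0 = 0"
  by (rule poly_mapping_eqI) (simp add: lookup_part)

lemma part_add: "part K (a + b) = part K a + part K b"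
  by (rule poly_mapping_eqI) (simp add: lookup_part lookup_add when_def)

lemma part_diff: "part K (a - b) = part K a - part K b"
  by (rule poly_mapping_eqI) (simp add: lookup_part lookup_minus when_def)

lemma part_sum: "part K (\<Sum>i\<in>I. f i) = (\<Sum>i\<in>I. part K (f i))"
  by (induction I rule: infinite_finite_induct) (simp_all add: part_add)

lemma part_single: "part K (Poly_Mapping.single m c) = (if m \<in> K then Poly_Mapping.single m c else 0)"
  by (rule poly_mapping_eqI) (auto simp: lookup_part lookup_single when_def)

lemma keys_part: "Poly_Mapping.keys (part K a) = Poly_Mapping.keys a \<inter> K"
  by (auto simp: in_keys_iff lookup_part split: if_splits)

lemma part_eq_self_iff: "part K a = a \<longleftrightarrow> Poly_Mapping.keys a \<subseteq> K"
proof
  assume "part K a = a"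
  then show "Poly_Mapping.keys a \<subseteq> K" using keys_part[of K a] by auto
next
  assume "Poly_Mapping.keys a \<subseteq> K"
  then show "part K a = a"
    by (intro poly_mapping_eqI) (auto simp: lookup_part when_def in_keys_iff)
qed

lemma part_eq_0:
  assumes "Poly_Mapping.keys a \<inter> K = {}"
  shows "part K a = 0"
  using assms by (simp flip: keys_eq_empty add: keys_part)

section \<open>Congruence classes of exponents\<close>

lemma mem_ZMod: "m \<in> ZMod d k \<longleftrightarrow> d dvd m - k"
proof
  assume "m \<in> ZMod d k"
  then show "d dvd m - k" by (auto dest: rcos_zfact)
next
  assume "d dvd m - k"
  then obtain x where "m - k = d * x" by (rule dvdE)
  then have "m = x * d + k" by (simp add: algebra_simps)
  then show "m \<in> ZMod d k"
    by (auto simp: ZMod_def a_r_coset_def' int_Idl)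
qed

lemma carrier_ZFact: "carrier (ZFact d) = range (ZMod d)"
  by (auto simp: ZFact_def FactRing_def A_RCOSETS_def' ZMod_def)

lemma ZMod_eqI: "m \<in> ZMod d k \<Longrightarrow> ZMod d m = ZMod d k"
  by (simp add: ZMod_eq_mod mem_ZMod mod_eq_dvd_iff)

lemma ZFact_class_eq:
  assumes "K \<in> carrier (ZFact d)" "k \<in> K"
  shows "K = ZMod d k"
  using assms by (auto simp: carrier_ZFact dest: ZMod_eqI)

lemma ZFact_nonempty:
  assumes "K \<in> carrier (ZFact d)"
  shows "K \<noteq> {}"
proof -
  have "k \<in> ZMod d k" for k by (simp add: mem_ZMod)
  then show ?thesis using assms by (auto simp: carrier_ZFact)
qed

text \<open>
  Addition in \<open>\<int>/d\<int>\<close> is the elementwise sum of cosets, which is also how supports behave under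
  convolution.
\<close>

lemma keys_mult_ZFact:
  assumes "Poly_Mapping.keys (a :: laurent) \<subseteq> K" "Poly_Mapping.keys b \<subseteq> L"
  shows "Poly_Mapping.keys (a * b) \<subseteq> K \<oplus>\<^bsub>ZFact d\<^esub> L"
  using keys_mult[of a b] assms by (fastforce simp: ZFact_def FactRing_def set_add_def')

section \<open>The algebra generated by T and its inverse\<close>

text \<open>
  The exponents available from powers of \<open>T\<close> and of its inverse are exactly the multiples of \<open>s - 1\<close>;
  the powers of \<open>q\<close> that come along are invertible, so rescaling reaches every coefficient.
\<close>

lemma single_in_T_algebra:
  assumes q: "q \<noteq> 0" and S: "subalgebra S" "T_elt q s \<in> S" "T_inv q s \<in> S"
    and m: "(s - 1) dvd m"
  shows "Poly_Mapping.single m c \<in> S"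
proof -
  interpret vector_space lscale by (rule vector_space_lscale)
  have S': "subspace S" "1 \<in> S" "\<And>a b. a \<in> S \<Longrightarrow> b \<in> S \<Longrightarrow> a * b \<in> S"
    using S(1) by (auto simp: subalgebra_def)
  have pow: "a ^ n \<in> S" if "a \<in> S" for a and n :: nat
    using that by (induction n) (simp_all add: S')
  have powers: "Poly_Mapping.single m c ^ n = Poly_Mapping.single (int n * m) (c ^ n)"
    for m and c :: complex and n :: nat
    by (induction n) (simp_all add: mult_single algebra_simps)
  obtain j where j: "m = (s - 1) * j" using m by (rule dvdE)
  have "\<exists>c'. c' \<noteq> 0 \<and> Poly_Mapping.single m c' \<in> S"
  proof (cases j rule: int_cases2)
    case (nonneg n)
    then show ?thesis
      using pow[OF S(2), of n] q by (intro exI[of _ "q ^ n"]) (simp add: j T_elt_def powers mult.commute)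
  next
    case (nonpos n)
    then have "m = int n * (1 - s)" by (simp add: j algebra_simps)
    then show ?thesis
      using pow[OF S(3), of n] q by (intro exI[of _ "inverse q ^ n"]) (simp add: T_inv_def powers)
  qed
  then obtain c' where c': "c' \<noteq> 0" "Poly_Mapping.single m c' \<in> S" by blast
  have "lscale (c / c') (Poly_Mapping.single m c') \<in> S"
    using S'(1) c'(2) by (rule subspace_scale)
  then show ?thesis using c'(1) by (simp add: lscale_single)
qed

lemma laurent_eq_sum_singles:
  "(a :: laurent) = (\<Sum>k\<in>Poly_Mapping.keys a. Poly_Mapping.single k (Poly_Mapping.lookup a k))"
  by (rule poly_mapping_eqI) (auto simp: lookup_sum lookup_single when_def in_keys_iff)

lemma keys_lscale: "Poly_Mapping.keys (lscale c a) \<subseteq> Poly_Mapping.keys a"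
  by (auto simp: lscale_def in_keys_iff map.rep_eq when_def)

lemma T_algebra_eq:
  assumes q: "q \<noteq> 0"
  shows "T_algebra q s = {f. Poly_Mapping.keys f \<subseteq> ZMod \<bar>s - 1\<bar> 0}" (is "_ = ?R")
proof
  interpret vector_space lscale by (rule vector_space_lscale)
  have "Poly_Mapping.keys (a * b) \<subseteq> ZMod \<bar>s - 1\<bar> 0" if "a \<in> ?R" "b \<in> ?R" for a b
  proof
    fix m assume "m \<in> Poly_Mapping.keys (a * b)"
    then obtain i j where "i \<in> Poly_Mapping.keys a" "j \<in> Poly_Mapping.keys b" "m = i + j"
      using keys_mult[of a b] by blast
    then show "m \<in> ZMod \<bar>s - 1\<bar> 0" using that by (auto simp: mem_ZMod subset_iff)
  qed
  moreover have "subspace ?R"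
  proof (rule subspaceI)
    show "a + b \<in> ?R" if "a \<in> ?R" "b \<in> ?R" for a b
      using that keys_add[of a b] by blast
    show "lscale c a \<in> ?R" if "a \<in> ?R" for c a
      using that keys_lscale[of c a] by blast
  qed simp
  moreover have "1 \<in> ?R" by (simp add: mem_ZMod)
  ultimately have "subalgebra ?R"
    unfolding subalgebra_def by blast
  moreover have "{T_elt q s, T_inv q s} \<subseteq> ?R"
    using dvd_minus_iff[of "s - 1" "s - 1"] by (simp add: T_elt_def T_inv_def mem_ZMod)
  ultimately show "T_algebra q s \<subseteq> ?R"
    unfolding T_algebra_def by (intro hull_minimal)
  show "?R \<subseteq> T_algebra q s"
  proof
    fix f assume f: "f \<in> ?R"
    have "f \<in> S" if S: "subalgebra S" "{T_elt q s, T_inv q s} \<subseteq> S" for S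
    proof -
      have "subspace S" using S(1) by (simp add: subalgebra_def)
      then have "(\<Sum>k\<in>Poly_Mapping.keys f. Poly_Mapping.single k (Poly_Mapping.lookup f k)) \<in> S"
      proof (rule subspace_sum)
        fix k assume "k \<in> Poly_Mapping.keys f"
        then have "(s - 1) dvd k" using f by (auto simp: mem_ZMod)
        then show "Poly_Mapping.single k (Poly_Mapping.lookup f k) \<in> S"
          using S by (intro single_in_T_algebra[OF q]) auto
      qed
      then show ?thesis by (simp only: laurent_eq_sum_singles[symmetric])
    qed
    then show "f \<in> T_algebra q s" by (auto simp: T_algebra_def hull_def)
  qed
qed

section \<open>Multiples of a fixed operator with prescribed support\<close>

definition supported_multiples :: "(laurent \<Rightarrow> laurent) \<Rightarrow> int set \<Rightarrow> (laurent \<Rightarrow> laurent) set"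
  where "supported_multiples \<Delta> K = {lact a \<Delta> | a. Poly_Mapping.keys a \<subseteq> K}"

lemma lact_0: "lact 0 \<Delta> = 0"
  by (simp add: lact_def fun_eq_iff)

lemma lact_add: "lact (a + b) \<Delta> = lact a \<Delta> + lact b \<Delta>"
  by (simp add: lact_def fun_eq_iff distrib_right)

lemma lact_sum: "lact (\<Sum>i\<in>I. f i) \<Delta> = (\<Sum>i\<in>I. lact (f i) \<Delta>)"
  by (induction I rule: infinite_finite_induct) (simp_all add: lact_0 lact_add)

lemma lact_lscale: "lact (lscale c a) \<Delta> = lmap_scale c (lact a \<Delta>)"
  by (simp add: lact_def lmap_scale_def lscale_conv fun_eq_iff mult.assoc)

text \<open>
  The factor \<open>- t\<^sup>k\<close> in the basis element is invertible and shifts exponents by \<open>k\<close>.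
\<close>

lemma T_span_eq:
  assumes q: "q \<noteq> 0"
  shows "T_span q s \<Delta> k = supported_multiples \<Delta> (ZMod \<bar>s - 1\<bar> k)"
proof (intro equalityI subsetI)
  fix D assume "D \<in> T_span q s \<Delta> k"
  then obtain f where f: "Poly_Mapping.keys f \<subseteq> ZMod \<bar>s - 1\<bar> 0" "D = lact f (basis_elt \<Delta> k)"
    by (auto simp: T_span_def T_algebra_eq[OF q])
  have "D = lact (f * (- Poly_Mapping.single k 1)) \<Delta>"
    by (simp add: f(2) basis_elt_def lact_def fun_eq_iff mult.assoc)
  moreover have "Poly_Mapping.keys (f * (- Poly_Mapping.single k 1)) \<subseteq> ZMod \<bar>s - 1\<bar> k"
    using keys_mult[of f "- Poly_Mapping.single k 1"] f(1) by (fastforce simp: mem_ZMod)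
  ultimately show "D \<in> supported_multiples \<Delta> (ZMod \<bar>s - 1\<bar> k)"
    unfolding supported_multiples_def by blast
next
  fix D assume "D \<in> supported_multiples \<Delta> (ZMod \<bar>s - 1\<bar> k)"
  then obtain a where a: "Poly_Mapping.keys a \<subseteq> ZMod \<bar>s - 1\<bar> k" "D = lact a \<Delta>"
    by (auto simp: supported_multiples_def)
  define f where "f = a * (- Poly_Mapping.single (- k) 1)"
  have "Poly_Mapping.keys f \<subseteq> ZMod \<bar>s - 1\<bar> 0"
    using keys_mult[of a "- Poly_Mapping.single (- k) 1"] a(1) by (fastforce simp: f_def mem_ZMod)
  moreover have "f * (- Poly_Mapping.single k 1) = a"
    by (simp add: f_def mult.assoc mult_single)
  then have "D = lact f (basis_elt \<Delta> k)"
    by (simp only: a(2) basis_elt_def lact_def flip: mult.assoc)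
  ultimately show "D \<in> T_span q s \<Delta> k"
    by (auto simp: T_span_def T_algebra_eq[OF q])
qed

lemma subspace_supported_multiples:
  "module.subspace lmap_scale (supported_multiples \<Delta> K)"
proof -
  interpret vector_space lmap_scale by (rule vector_space_lmap_scale)
  show ?thesis
  proof (rule subspaceI)
    have "lact 0 \<Delta> \<in> supported_multiples \<Delta> K" by (auto simp: supported_multiples_def)
    then show "0 \<in> supported_multiples \<Delta> K" by (simp add: lact_0)
  next
    fix D E assume "D \<in> supported_multiples \<Delta> K" "E \<in> supported_multiples \<Delta> K"
    then obtain a b where ab: "Poly_Mapping.keys a \<subseteq> K" "D = lact a \<Delta>"
        "Poly_Mapping.keys b \<subseteq> K" "E = lact b \<Delta>"
      by (auto simp: supported_multiples_def)
    then have "Poly_Mapping.keys (a + b) \<subseteq> K" using keys_add[of a b] by blast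
    then show "D + E \<in> supported_multiples \<Delta> K"
      unfolding supported_multiples_def ab(2,4) lact_add[symmetric] by blast
  next
    fix c D assume "D \<in> supported_multiples \<Delta> K"
    then obtain a where a: "Poly_Mapping.keys a \<subseteq> K" "D = lact a \<Delta>"
      by (auto simp: supported_multiples_def)
    then have "Poly_Mapping.keys (lscale c a) \<subseteq> K" using keys_lscale[of c a] by blast
    then show "lmap_scale c D \<in> supported_multiples \<Delta> K"
      unfolding supported_multiples_def a(2) lact_lscale[symmetric] by blast
  qed
qed

text \<open>
  The direct sum property holds for any partition of the exponents: the component of \<open>a \<Delta>\<close> in the block
  \<open>K\<close> is \<open>(part K a) \<Delta>\<close>, and only the blocks that meet the finite support of \<open>a\<close> contribute. The
  function \<open>cl\<close> assigns to an exponent its block. Injectivity carries both the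
  vanishing of a component and the uniqueness of the decomposition over to coefficients.
\<close>

lemma is_direct_sum_supported_multiples:
  assumes inj: "inj (\<lambda>a. lact a \<Delta>)"
    and disj: "\<And>K L. K \<in> P \<Longrightarrow> L \<in> P \<Longrightarrow> K \<noteq> L \<Longrightarrow> K \<inter> L = {}"
    and cover: "\<And>m. cl m \<in> P \<and> m \<in> cl m"
  shows "is_direct_sum lmap_scale (range (\<lambda>a. lact a \<Delta>)) P (supported_multiples \<Delta>)"
proof -
  interpret vector_space lmap_scale by (rule vector_space_lmap_scale)
  have cl: "K = cl m" if "K \<in> P" "m \<in> K" for K m
    using that cover[of m] disj[of K "cl m"] by blast
  have range_eq: "range (\<lambda>a. lact a \<Delta>) = supported_multiples \<Delta> UNIV"
    by (auto simp: supported_multiples_def)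
  have zero: "lact a \<Delta> = 0 \<longleftrightarrow> a = 0" for a
    using inj lact_0 by (metis injD)
  \<comment> \<open>Uniqueness: applying \<open>part K\<close> to the coefficients of a decomposition kills all summands but one.\<close>
  have unique: "w K = lact (part K a) \<Delta>"
    if w: "\<forall>K\<in>P. w K \<in> supported_multiples \<Delta> K" "\<forall>K. K \<notin> P \<longrightarrow> w K = 0"
      "finite {K. w K \<noteq> 0}" "lact a \<Delta> = (\<Sum>K | w K \<noteq> 0. w K)" and K: "K \<in> P" for w a K
  proof -
    have "\<forall>L. \<exists>b. w L = lact b \<Delta> \<and> (L \<in> P \<longrightarrow> Poly_Mapping.keys b \<subseteq> L) \<and> (L \<notin> P \<longrightarrow> b = 0)"
    proof
      fix L
      show "\<exists>b. w L = lact b \<Delta> \<and> (L \<in> P \<longrightarrow> Poly_Mapping.keys b \<subseteq> L) \<and> (L \<notin> P \<longrightarrow> b = 0)"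
        using w(1,2) lact_0[of \<Delta>] by (cases "L \<in> P") (fastforce simp: supported_multiples_def)+
    qed
    then obtain b where b: "\<And>L. w L = lact (b L) \<Delta>" "\<And>L. L \<in> P \<Longrightarrow> Poly_Mapping.keys (b L) \<subseteq> L"
      "\<And>L. L \<notin> P \<Longrightarrow> b L = 0"
      by metis
    have "lact a \<Delta> = lact (\<Sum>L | b L \<noteq> 0. b L) \<Delta>"
      using w(4) by (simp add: b(1) zero lact_sum)
    then have "a = (\<Sum>L | b L \<noteq> 0. b L)" using inj by (blast dest: injD)
    then have "part K a = (\<Sum>L | b L \<noteq> 0. part K (b L))" by (simp add: part_sum)
    also have "\<dots> = (\<Sum>L | b L \<noteq> 0. if L = K then b K else 0)"
    proof (rule sum.cong[OF refl])
      fix L assume "L \<in> {L. b L \<noteq> 0}"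
      then have "L \<in> P" using b(3) by blast
      then show "part K (b L) = (if L = K then b K else 0)"
        using b(2)[of L] disj[of L K] K by (auto simp: part_eq_self_iff intro!: part_eq_0)
    qed
    also have "\<dots> = b K" using w(3) by (auto simp: b(1) zero)
    finally show ?thesis by (simp add: b(1))
  qed
  have "\<exists>!w. (\<forall>K\<in>P. w K \<in> supported_multiples \<Delta> K) \<and> (\<forall>K. K \<notin> P \<longrightarrow> w K = 0) \<and>
      finite {K. w K \<noteq> 0} \<and> lact a \<Delta> = (\<Sum>K | w K \<noteq> 0. w K)" for a
  proof (rule ex_ex1I)
    \<comment> \<open>The set \<open>?C\<close> of blocks meeting the support of \<open>a\<close> is finite and contains every contributing block.\<close>
    let ?w = "\<lambda>K. if K \<in> P then lact (part K a) \<Delta> else 0"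
    let ?C = "cl ` Poly_Mapping.keys a"
    have C: "{K. ?w K \<noteq> 0} \<subseteq> ?C"
    proof
      fix K assume "K \<in> {K. ?w K \<noteq> 0}"
      then have K: "K \<in> P" "part K a \<noteq> 0" by (auto simp: zero split: if_splits)
      then obtain m where "m \<in> Poly_Mapping.keys a" "m \<in> K" using part_eq_0[of a K] by blast
      then show "K \<in> ?C" using cl[OF K(1)] by blast
    qed
    have "(\<Sum>K\<in>?C. part K a) = a"
    proof (rule poly_mapping_eqI)
      fix m
      have "(Poly_Mapping.lookup a m when m \<in> K) = (if K = cl m then Poly_Mapping.lookup a m else 0)"
        if "K \<in> ?C" for K
      proof -
        have "m \<in> K \<longleftrightarrow> K = cl m" using that cover cl[of K m] by blast
        then show ?thesis by (simp add: when_def)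
      qed
      then have "Poly_Mapping.lookup (\<Sum>K\<in>?C. part K a) m =
          (\<Sum>K\<in>?C. if K = cl m then Poly_Mapping.lookup a m else 0)"
        unfolding lookup_sum lookup_part by (intro sum.cong refl)
      also have "\<dots> = (if cl m \<in> ?C then Poly_Mapping.lookup a m else 0)"
        by (simp only: sum.delta finite_imageI finite_keys)
      also have "\<dots> = Poly_Mapping.lookup a m"
      proof (cases "m \<in> Poly_Mapping.keys a")
        case True
        then have "cl m \<in> ?C" by (rule imageI)
        then show ?thesis by (rule if_P)
      next
        case False
        then have "Poly_Mapping.lookup a m = 0" by (simp add: in_keys_iff)
        then show ?thesis by (simp only: if_cancel)
      qed
      finally show "Poly_Mapping.lookup (\<Sum>K\<in>?C. part K a) m = Poly_Mapping.lookup a m" .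
    qed
    then have "lact a \<Delta> = (\<Sum>K\<in>?C. lact (part K a) \<Delta>)" by (simp only: lact_sum[symmetric])
    also have "\<dots> = (\<Sum>K\<in>?C. ?w K)"
    proof (rule sum.cong[OF refl])
      fix K assume "K \<in> ?C"
      then have "K \<in> P" using cover by blast
      then show "lact (part K a) \<Delta> = ?w K" by (rule if_P[symmetric])
    qed
    also have "\<dots> = (\<Sum>K | ?w K \<noteq> 0. ?w K)" using C by (intro sum.mono_neutral_right) auto
    finally have "lact a \<Delta> = (\<Sum>K | ?w K \<noteq> 0. ?w K)" .
    moreover have "finite {K. ?w K \<noteq> 0}" using C by (rule finite_subset) simp
    moreover have "\<forall>K\<in>P. ?w K \<in> supported_multiples \<Delta> K"
      by (auto simp: supported_multiples_def keys_part)
    moreover have "\<forall>K. K \<notin> P \<longrightarrow> ?w K = 0" by simp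
    ultimately show "\<exists>w. (\<forall>K\<in>P. w K \<in> supported_multiples \<Delta> K) \<and> (\<forall>K. K \<notin> P \<longrightarrow> w K = 0) \<and>
      finite {K. w K \<noteq> 0} \<and> lact a \<Delta> = (\<Sum>K | w K \<noteq> 0. w K)"
      by (intro exI[of _ ?w] conjI)
  next
    fix w w'
    assume w: "(\<forall>K\<in>P. w K \<in> supported_multiples \<Delta> K) \<and> (\<forall>K. K \<notin> P \<longrightarrow> w K = 0) \<and>
      finite {K. w K \<noteq> 0} \<and> lact a \<Delta> = (\<Sum>K | w K \<noteq> 0. w K)"
    and w': "(\<forall>K\<in>P. w' K \<in> supported_multiples \<Delta> K) \<and> (\<forall>K. K \<notin> P \<longrightarrow> w' K = 0) \<and>
      finite {K. w' K \<noteq> 0} \<and> lact a \<Delta> = (\<Sum>K | w' K \<noteq> 0. w' K)"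
    show "w = w'"
    proof
      fix K
      show "w K = w' K"
        using unique[of w a K] unique[of w' a K] w w' by metis
    qed
  qed
  moreover have "supported_multiples \<Delta> K \<subseteq> range (\<lambda>a. lact a \<Delta>)" for K
    by (auto simp: supported_multiples_def)
  moreover have "subspace (range (\<lambda>a. lact a \<Delta>))"
    unfolding range_eq by (rule subspace_supported_multiples)
  ultimately show ?thesis
    unfolding is_direct_sum_def
    by (intro conjI ballI subspace_supported_multiples) (assumption | erule rangeE, simp only:)+
qed

lemma is_direct_sum_cong:
  assumes "\<And>i. i \<in> I \<Longrightarrow> W i = W' i"
  shows "is_direct_sum scale V I W = is_direct_sum scale V I W'"
  using assms by (simp add: is_direct_sum_def cong: ball_cong)

section \<open>The endomorphism and the twisted derivation preserve classes\<close>

lemma part_ZMod_mult_single: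
  assumes "d dvd n"
  shows "part (ZMod d k) (Poly_Mapping.single n c * b) = Poly_Mapping.single n c * part (ZMod d k) b"
proof (induction b rule: laurent_induct)
  case (single m x)
  have "d dvd n + m - k \<longleftrightarrow> d dvd m - k"
    using dvd_add_right_iff[OF assms, of "m - k"] by (simp add: algebra_simps)
  then show ?case by (simp add: mult_single part_single mem_ZMod)
next
  case (add a b)
  then show ?case by (simp add: distrib_left part_add)
qed

context
  fixes q :: complex and s :: int and \<sigma> :: "laurent \<Rightarrow> laurent"
  assumes q: "q \<noteq> 0" and endo: "alg_endo \<sigma>"
    and t: "\<sigma> (Poly_Mapping.single 1 1) = Poly_Mapping.single s q" and nontriv: "\<sigma> \<noteq> id"
begin

text \<open>
  The monomial of exponent \<open>m\<close> goes to one of exponent \<open>s m = m + (s - 1) m\<close>, in the same class.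
\<close>

lemma endo_part: "\<sigma> (part (ZMod \<bar>s - 1\<bar> k) a) = part (ZMod \<bar>s - 1\<bar> k) (\<sigma> a)"
proof -
  have add: "\<sigma> (a + b) = \<sigma> a + \<sigma> b" and zero: "\<sigma> 0 = 0" for a b
    using endo endo_single[OF q endo t, of 0 0] by (simp_all add: alg_endo_def linear_iff_lscale)
  show ?thesis
  proof (induction a rule: laurent_induct)
    case (single m c)
    have "s * m - k = (s - 1) * m + (m - k)" by (simp add: algebra_simps)
    then have "(s - 1) dvd s * m - k \<longleftrightarrow> (s - 1) dvd m - k"
      by (simp only: dvd_add_right_iff[OF dvd_triv_left])
    then show ?case by (simp add: part_single endo_single[OF q endo t] zero mem_ZMod)
  next
    case (add a b)
    then show ?case by (simp add: part_add \<open>\<And>a b. \<sigma> (a + b) = \<sigma> a + \<sigma> b\<close>)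
  qed
qed

text \<open>
  Both exponents that occur in \<open>g\<close>, namely \<open>0\<close> and \<open>d\<close>, are divisible by \<open>d\<close>.
\<close>

lemma part_gcd_elt_mult:
  "part (ZMod \<bar>s - 1\<bar> k) (gcd_elt q s * b) = gcd_elt q s * part (ZMod \<bar>s - 1\<bar> k) b"
proof -
  have "\<bar>s - 1\<bar> dvd s - 1" "\<bar>s - 1\<bar> dvd 1 - s"
    using dvd_minus_iff[of "s - 1" "s - 1"] by simp_all
  then show ?thesis
    by (simp add: gcd_elt_def left_diff_distrib part_diff part_ZMod_mult_single)
qed

text \<open>
  \<open>\<Delta>(a)\<close> is the only solution \<open>b\<close> of \<open>g b = a - \<sigma>(a)\<close>, and \<open>part\<close> commutes with every operation in
  this equation.
\<close>

lemma Delta_part: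
  "Delta q s \<sigma> (part (ZMod \<bar>s - 1\<bar> k) a) = part (ZMod \<bar>s - 1\<bar> k) (Delta q s \<sigma> a)"
proof (rule sym, subst Delta_eq[OF q endo t nontriv, symmetric])
  have "gcd_elt q s * Delta q s \<sigma> a = a - \<sigma> a"
    using Delta_eq[OF q endo t nontriv] by blast
  then show "gcd_elt q s * part (ZMod \<bar>s - 1\<bar> k) (Delta q s \<sigma> a) =
      part (ZMod \<bar>s - 1\<bar> k) a - \<sigma> (part (ZMod \<bar>s - 1\<bar> k) a)"
    by (simp add: endo_part flip: part_gcd_elt_mult part_diff)
qed

lemma bracket_supported_multiples:
  assumes K: "K \<in> carrier (ZFact \<bar>s - 1\<bar>)" and L: "L \<in> carrier (ZFact \<bar>s - 1\<bar>)"
    and D: "D \<in> supported_multiples (Delta q s \<sigma>) K" and E: "E \<in> supported_multiples (Delta q s \<sigma>) L"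
  shows "sigma_bracket \<sigma> (Delta q s \<sigma>) D E \<in>
    supported_multiples (Delta q s \<sigma>) (K \<oplus>\<^bsub>ZFact \<bar>s - 1\<bar>\<^esub> L)"
proof -
  let ?\<Delta> = "Delta q s \<sigma>" and ?KL = "K \<oplus>\<^bsub>ZFact \<bar>s - 1\<bar>\<^esub> L"
  obtain a where a: "Poly_Mapping.keys a \<subseteq> K" "D = lact a ?\<Delta>"
    using D by (auto simp: supported_multiples_def)
  obtain b where b: "Poly_Mapping.keys b \<subseteq> L" "E = lact b ?\<Delta>"
    using E by (auto simp: supported_multiples_def)
  have pres: "Poly_Mapping.keys (\<sigma> x) \<subseteq> M" "Poly_Mapping.keys (?\<Delta> x) \<subseteq> M"
    if carr: "M \<in> carrier (ZFact \<bar>s - 1\<bar>)" and x: "Poly_Mapping.keys x \<subseteq> M" for M x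
  proof -
    obtain k where M: "M = ZMod \<bar>s - 1\<bar> k" using carr by (auto simp: carrier_ZFact)
    have "part M x = x" using x by (simp add: part_eq_self_iff)
    then have "part M (\<sigma> x) = \<sigma> x" "part M (?\<Delta> x) = ?\<Delta> x"
      using endo_part[of k x] Delta_part[of k x] by (simp_all add: M)
    then show "Poly_Mapping.keys (\<sigma> x) \<subseteq> M" "Poly_Mapping.keys (?\<Delta> x) \<subseteq> M"
      by (simp_all add: part_eq_self_iff)
  qed
  have "Poly_Mapping.keys (\<sigma> a * ?\<Delta> b) \<subseteq> ?KL"
    using pres(1)[OF K a(1)] pres(2)[OF L b(1)] by (rule keys_mult_ZFact)
  moreover have "Poly_Mapping.keys (\<sigma> b * ?\<Delta> a) \<subseteq> ?KL"
    using keys_mult_ZFact[OF pres(2)[OF K a(1)] pres(1)[OF L b(1)]] by (simp add: mult.commute)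
  ultimately have "Poly_Mapping.keys (\<sigma> a * ?\<Delta> b - \<sigma> b * ?\<Delta> a) \<subseteq> ?KL"
    using keys_diff[of "\<sigma> a * ?\<Delta> b" "\<sigma> b * ?\<Delta> a"] by blast
  then show ?thesis
    unfolding a(2) b(2) sigma_bracket_lact[OF q endo t nontriv] supported_multiples_def by blast
qed

lemma inj_lact_Delta: "inj (\<lambda>a. lact a (Delta q s \<sigma>))"
  by (rule inj_on_inverseI) (rule coeff_of_lact[OF q endo t nontriv])

end

theorem theorem4p3p3:
  fixes q :: complex and s :: int and \<sigma> :: "laurent \<Rightarrow> laurent"
  assumes "q \<noteq> 0"
    and "alg_endo \<sigma>"
    and "\<sigma> (Poly_Mapping.single 1 1) = Poly_Mapping.single s q"
    and "\<sigma> \<noteq> id"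
  defines "\<Delta> \<equiv> Delta q s \<sigma>" and "Zd \<equiv> ZFact \<bar>s - 1\<bar>"
  shows "(\<forall>K\<in>carrier Zd. \<forall>k\<in>K. component q s \<Delta> K = T_span q s \<Delta> k) \<and>
    is_direct_sum lmap_scale (sigma_derivations \<sigma>) (carrier Zd) (component q s \<Delta>) \<and>
    (\<forall>K\<in>carrier Zd. \<forall>L\<in>carrier Zd. \<forall>D\<in>component q s \<Delta> K. \<forall>E\<in>component q s \<Delta> L.
       sigma_bracket \<sigma> \<Delta> D E \<in> component q s \<Delta> (K \<oplus>\<^bsub>Zd\<^esub> L))"
proof -
  have span: "T_span q s \<Delta> k = supported_multiples \<Delta> K" if "K \<in> carrier Zd" "k \<in> K" for K k
    using that ZFact_class_eq[of K "\<bar>s - 1\<bar>" k] by (simp add: Zd_def T_span_eq[OF assms(1)])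
  have component: "component q s \<Delta> K = supported_multiples \<Delta> K" if "K \<in> carrier Zd" for K
    using that span[OF that] ZFact_nonempty[of K] unfolding component_def Zd_def
    by (metis some_in_eq)
  have "is_direct_sum lmap_scale (range (\<lambda>a. lact a \<Delta>)) (carrier Zd) (supported_multiples \<Delta>)"
  proof (rule is_direct_sum_supported_multiples)
    show "inj (\<lambda>a. lact a \<Delta>)" unfolding \<Delta>_def by (rule inj_lact_Delta[OF assms(1-4)])
    show "K \<inter> L = {}" if "K \<in> carrier Zd" "L \<in> carrier Zd" "K \<noteq> L" for K L
      using that ZFact_class_eq unfolding Zd_def by blast
    show "ZMod \<bar>s - 1\<bar> m \<in> carrier Zd \<and> m \<in> ZMod \<bar>s - 1\<bar> m" for m
      by (simp add: Zd_def carrier_ZFact mem_ZMod)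
  qed
  then have "is_direct_sum lmap_scale (sigma_derivations \<sigma>) (carrier Zd) (component q s \<Delta>)"
    unfolding sigma_derivations_eq[OF assms(1-4)] \<Delta>_def[symmetric]
    by (simp only: is_direct_sum_cong[OF component])
  moreover have "K \<oplus>\<^bsub>Zd\<^esub> L \<in> carrier Zd" if "K \<in> carrier Zd" "L \<in> carrier Zd" for K L
  proof -
    interpret cring Zd unfolding Zd_def by (rule ZFact_is_cring)
    show ?thesis using that by (rule add.m_closed)
  qed
  then have "sigma_bracket \<sigma> \<Delta> D E \<in> component q s \<Delta> (K \<oplus>\<^bsub>Zd\<^esub> L)"
    if "K \<in> carrier Zd" "L \<in> carrier Zd" "D \<in> component q s \<Delta> K" "E \<in> component q s \<Delta> L" for K L D E
    using that component bracket_supported_multiples[OF assms(1-4), of K L D E]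
    by (simp add: Zd_def \<Delta>_def)
  ultimately show ?thesis
    using span component by blast
qed

end
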